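(* Let $d\ge 1$ be an integer, let $p>0$, and let $\{\xi(\mathbf{n}),\ \mathbf{n}\in\mathbb{N}_0^d\}$ be a real-valued random field. Suppose that, for $s=1,\dots,d$, $\varphi_s:\mathbb{R}_+\to\mathbb{R}_+$ is an increasing function satisfying $C_3<\varphi_s(2x)/\varphi_s(x)<C_4$ for all $x\in\mathbb{R}_+$, for some constants $C_4\ge C_3>1$. Assume $a\ge 2$ is an integer that satisfies $C_3^{p\lfloor\log_2 a\rfloor}>\max\{a,\ a2^{p-1}\}$. If $$\sum_{\mathbf{n}\in\mathbb{N}_0^d}\ \sup_{\mathbf{m}\in\mathbb{N}_0^d}\mathbb{E}\left(\frac{|S(\mathbf{m};a^{n_1},\dots,a^{n_d})|^p}{\varphi_1(a^{n_1})^p\cdots\varphi_d(a^{n_d})^p}\right)<\infty,$$ then $$\lim_{|\mathbf{n}|\to\infty}\frac{\sum_{\mathbf{k}\in[\mathbf{1},\mathbf{n}]}\xi(\mathbf{k})}{\varphi_1(n_1)\cdots\varphi_d(n_d)}=0\quad\text{almost surely},$$ where $\mathbf{n}=(n_1,\dots,n_d)$ ranges over $\mathbb{N}^d$.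
   Context: $\mathbb{N}=\{1,2,\dots\}$, $\mathbb{N}_0=\mathbb{N}\cup\{0\}$, $\mathbb{R}_+=(0,\infty)$. For $\mathbf{n}=(n_1,\dots,n_d)\in\mathbb{N}_0^d$, $|\mathbf{n}|=\max\{n_1,\dots,n_d\}$. The partial order on $\mathbb{N}_0^d$ is coordinatewise, $[\mathbf{m},\mathbf{n}]=\{\mathbf{k}\in\mathbb{N}_0^d:\mathbf{m}\le\mathbf{k}\le\mathbf{n}\}$, and $\mathbf{1}=(1,\dots,1)$. For $\mathbf{m},\mathbf{n}\in\mathbb{N}_0^d$, $$S(\mathbf{m};\mathbf{n})=S(\mathbf{m};n_1,\dots,n_d)=\sum_{k_1=m_1+1}^{m_1+n_1}\cdots\sum_{k_d=m_d+1}^{m_d+n_d}\xi(k_1,\dots,k_d).$$ No independence or stationarity assumption is made on the random field. *)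

theory Defs
  imports "HOL-Probability.Probability"
begin

text \<open>
  Multi-indices of dimension \<open>d = CARD('d)\<close> are vectors of type \<open>nat ^ 'd\<close>, whose library order,
  addition and \<open>1\<close> are coordinatewise; hence \<open>{m..n}\<close> is the box of all \<open>k\<close> with
  \<open>m\<^sub>i \<le> k\<^sub>i \<le> n\<^sub>i\<close> for every \<open>i\<close>.
\<close>

definition max_norm :: "nat ^ 'd \<Rightarrow> nat" where
  "max_norm n = Max (range (\<lambda>i. n $ i))"

text \<open>The \<open>d\<close>-fold sum with \<open>k\<^sub>i\<close> running from \<open>m\<^sub>i + 1\<close> to \<open>m\<^sub>i + n\<^sub>i\<close>.\<close>

definition block_sum :: "(nat ^ 'd \<Rightarrow> 'a \<Rightarrow> real) \<Rightarrow> nat ^ 'd \<Rightarrow> nat ^ 'd \<Rightarrow> 'a \<Rightarrow> real" where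
  "block_sum \<xi> m n \<omega> = (\<Sum>k\<in>{m + 1..m + n}. \<xi> k \<omega>)"

text \<open>
  Convergence as \<open>max_norm n\<close> tends to infinity, with \<open>n\<close> restricted to multi-indices all of whose
  coordinates are positive. The smallest coordinate need not tend to infinity.
\<close>

definition at_max_norm_infinity :: "(nat ^ 'd) filter" where
  "at_max_norm_infinity = inf (filtercomap max_norm at_top) (principal {n. \<forall>i. 1 \<le> n $ i})"

end

theory Submission
  imports Defs
begin

text \<open>
  Expanding \<open>n\<close> in base \<open>a\<close> in each coordinate splits the box from \<open>1\<close> to \<open>n\<close> into aligned blocks of side
  lengths \<open>a\<^bsup>j\<^esup>\<close>, with at most \<open>a\<^bsup>d\<^esup>\<close> blocks for each level vector \<open>j \<le> N\<close>, where \<open>a\<^bsup>N\<^esup> \<le> n < a\<^bsup>N+1\<^esup>\<close>.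
  Doubling gives \<open>\<phi>(a\<^bsup>j\<^esup>) \<le> \<rho>\<^bsup>|N-j|\<^esup> \<phi>(a\<^bsup>N\<^esup>)\<close> (\<open>|\<cdot>|\<close> being the sum of the coordinates) with
  \<open>\<rho>\<^bsup>p\<^esup> a < 1\<close>. Writing \<open>\<rho>\<^bsup>|N-j|\<^esup> = \<theta>\<^bsup>|N-j|\<^esup> (\<rho>/\<theta>)\<^bsup>|N-j|\<^esup>\<close> with \<open>\<theta> < 1\<close> slightly above \<open>\<rho> a\<^bsup>1/p\<^esup>\<close>,
  the normalised sum over the box is at most a constant times \<open>Z\<^sub>N\<^bsup>1/p\<^esup>\<close>, where \<open>Z\<^sub>N\<close> adds up
  \<open>\<eta>\<^bsup>|N-j|\<^esup>\<close> times the \<open>p\<close>-th powers of all normalised level-\<open>j\<close> blocks in the box of side \<open>a\<^bsup>N+1\<^esup>\<close>,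
  \<open>\<eta> = (\<rho>/\<theta>)\<^bsup>p\<^esup>\<close>. There are \<open>a\<^bsup>|N+1-j|\<^esup>\<close> such blocks and \<open>\<eta> a < 1\<close>, so the expectations of the \<open>Z\<^sub>N\<close>
  are summable, and almost surely only finitely many \<open>Z\<^sub>N\<close> exceed a given level. This treats all
  \<open>p > 0\<close> at once.
\<close>

section \<open>Sums and cardinalities over coordinate boxes\<close>

text \<open>\<open>vec_lambda\<close> and \<open>vec_nth\<close> identify vectors with functions on
  the index type, so this is distributivity in the form \<open>prod_sum_PiE\<close>. It reduces sums
  over level vectors to one coordinate at a time.\<close>

lemma sum_prod_vec_box:
  fixes f :: "'d::finite \<Rightarrow> 'b \<Rightarrow> 'c::comm_semiring_1"
  assumes "\<And>s. finite (B s)"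
  shows "(\<Sum>x\<in>{x. \<forall>s. x $ s \<in> B s}. \<Prod>s\<in>UNIV. f s (x $ s)) = (\<Prod>s\<in>UNIV. \<Sum>b\<in>B s. f s b)"
proof -
  have "(\<Sum>x\<in>{x. \<forall>s. x $ s \<in> B s}. \<Prod>s\<in>UNIV. f s (x $ s))
      = (\<Sum>g\<in>PiE UNIV B. \<Prod>s\<in>UNIV. f s (g s))"
    by (rule sum.reindex_bij_witness[of _ vec_lambda vec_nth]) (auto simp: PiE_iff)
  then show ?thesis
    using assms by (simp add: prod_sum_PiE)
qed

lemma finite_vec_box:
  fixes B :: "'d::finite \<Rightarrow> 'b set"
  assumes "\<And>s. finite (B s)"
  shows "finite {x. \<forall>s. x $ s \<in> B s}"
proof (rule finite_subset)
  show "{x. \<forall>s. x $ s \<in> B s} \<subseteq> vec_lambda ` PiE UNIV B"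
  proof
    fix x assume "x \<in> {x. \<forall>s. x $ s \<in> B s}"
    then have "vec_lambda (vec_nth x) \<in> vec_lambda ` PiE UNIV B"
      by (intro imageI) (auto simp: PiE_iff)
    then show "x \<in> vec_lambda ` PiE UNIV B" by simp
  qed
  show "finite (vec_lambda ` PiE UNIV B)"
    using assms by (intro finite_imageI finite_PiE) auto
qed

lemma card_vec_box:
  fixes B :: "'d::finite \<Rightarrow> 'b set"
  assumes "\<And>s. finite (B s)"
  shows "card {x. \<forall>s. x $ s \<in> B s} = (\<Prod>s\<in>UNIV. card (B s))"
  using sum_prod_vec_box[OF assms, of "\<lambda>_ _. 1 :: nat"] by simp

lemma atMost_vec_eq: "{..N :: nat ^ 'd::finite} = {x. \<forall>s. x $ s \<in> {..N $ s}}"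
  by (auto simp: less_eq_vec_def)

lemma finite_atMost_vec: "finite {..N :: nat ^ 'd::finite}"
  unfolding atMost_vec_eq by (rule finite_vec_box) simp

lemma finite_atLeastAtMost_vec: "finite {m..N :: nat ^ 'd::finite}"
  by (rule finite_subset[OF _ finite_atMost_vec[of N]]) auto

section \<open>Decomposition of a box by base-\<open>a\<close> digits\<close>

text \<open>Once the quotients of \<open>m\<close> and \<open>n\<close> by a power of
  \<open>a\<close> agree, they agree for all higher powers. So the least \<open>j\<close> with
  agreement at \<open>j + 1\<close> is the only one that still has disagreement at \<open>j\<close>,
  and monotonicity of division turns this disagreement into \<open><\<close>.\<close>

lemma highest_differing_digit_ex1:
  fixes a m n :: nat
  assumes "m < n" "n < a ^ (N + 1)"
  shows "\<exists>!j. j \<le> N \<and> m div a ^ (j + 1) = n div a ^ (j + 1) \<and> m div a ^ j < n div a ^ j"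
proof -
  define P where "P = (\<lambda>j. m div a ^ (j + 1) = n div a ^ (j + 1))"
  define J where "J = (LEAST j. P j)"
  have PN: "P N" using assms by (simp add: P_def)
  have PJ: "P J" unfolding J_def by (rule LeastI[of P, OF PN])
  have "J \<le> N" unfolding J_def by (rule Least_le[of P, OF PN])
  have JL: "J \<le> i" if "P i" for i unfolding J_def by (rule Least_le[of P, OF that])
  have less: "m div a ^ J < n div a ^ J"
  proof (cases J)
    case 0
    then show ?thesis using assms by simp
  next
    case (Suc i)
    then have "\<not> P i" using JL[of i] by auto
    then show ?thesis using Suc assms(1) div_le_mono[of m n "a ^ J"] by (simp add: P_def le_less)
  qed
  have up: "m div a ^ j = n div a ^ j" if "P i" "i < j" for i j
  proof -
    have "a ^ j = a ^ (i + 1) * a ^ (j - (i + 1))"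
      using that by (subst power_add[symmetric]) simp
    then show ?thesis using \<open>P i\<close> by (simp add: P_def div_mult2_eq)
  qed
  show ?thesis
  proof (rule ex1I[of _ J])
    show "J \<le> N \<and> m div a ^ (J + 1) = n div a ^ (J + 1) \<and> m div a ^ J < n div a ^ J"
      using \<open>J \<le> N\<close> PJ less by (simp add: P_def)
    fix j
    assume j: "j \<le> N \<and> m div a ^ (j + 1) = n div a ^ (j + 1) \<and> m div a ^ j < n div a ^ j"
    then have "P j" by (simp add: P_def)
    then show "j = J" using up[OF PJ, of j] JL[of j] j by force
  qed
qed

text \<open>
  For \<open>1 \<le> k \<le> n\<close> let \<open>j\<close> be the highest position at which the base-\<open>a\<close> digits of \<open>k - 1\<close> and \<open>n\<close> differ,
  coordinatewise. The \<open>k\<close> with level vector \<open>j\<close> fill the aligned blocks with corners \<open>q\<^sub>s a\<^bsup>j\<^sub>s\<^esup>\<close>,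
  where \<open>q\<close> ranges over the following set.
\<close>

definition digit_blocks :: "nat \<Rightarrow> nat ^ 'd \<Rightarrow> nat ^ 'd \<Rightarrow> (nat ^ 'd) set" where
  "digit_blocks a n j =
    {q. \<forall>s. q $ s \<in> {q. q div a = n $ s div a ^ (j $ s + 1) \<and> q < n $ s div a ^ (j $ s)}}"

lemma finite_digit_blocks: "finite (digit_blocks a n j)"
  unfolding digit_blocks_def by (rule finite_vec_box) auto

text \<open>Fixing \<open>q div a\<close> leaves at most \<open>a\<close> consecutive values in each
  coordinate.\<close>

lemma card_digit_blocks_le:
  fixes n :: "nat ^ 'd"
  assumes "a > 0"
  shows "card (digit_blocks a n j) \<le> a ^ CARD('d)"
proof -
  have "card {q. q div a = c \<and> q < d} \<le> a" for c d
  proof -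
    have "{q. q div a = c \<and> q < d} \<subseteq> {a * c..<a * c + a}"
      using assms dividend_less_times_div[of a] by (auto simp: add.commute)
    from card_mono[OF _ this] show ?thesis by simp
  qed
  then have "(\<Prod>s\<in>UNIV. card {q. q div a = n $ s div a ^ (j $ s + 1) \<and> q < n $ s div a ^ (j $ s)})
      \<le> (\<Prod>s\<in>(UNIV :: 'd set). a)"
    by (intro prod_mono) simp
  then show ?thesis
    unfolding digit_blocks_def by (subst card_vec_box) simp_all
qed

text \<open>Block sums start one step after the corner, so a block is a fibre of
  \<open>(k - 1) div b\<close> rather than of \<open>k div b\<close>.\<close>

lemma mem_block_iff:
  fixes q b k :: nat
  assumes "b > 0"
  shows "(q * b + 1 \<le> k \<and> k \<le> q * b + b) \<longleftrightarrow> (1 \<le> k \<and> (k - 1) div b = q)"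
proof -
  have "(k - 1) div b = q \<longleftrightarrow> q * b \<le> k - 1 \<and> k - 1 < q * b + b"
  proof
    assume "(k - 1) div b = q"
    then show "q * b \<le> k - 1 \<and> k - 1 < q * b + b"
      using assms dividend_less_times_div[of b "k - 1"] times_div_less_eq_dividend[of b "k - 1"]
      by (metis add.commute mult.commute)
  next
    assume "q * b \<le> k - 1 \<and> k - 1 < q * b + b"
    then show "(k - 1) div b = q" by (intro div_nat_eqI) (auto simp: algebra_simps)
  qed
  then show ?thesis by linarith
qed

text \<open>The points \<open>k\<close> are grouped by their level vector and by the quotients at
  that level. The top differing digit is unique in each coordinate, so the resulting blocks
  partition the box.\<close>

lemma sum_box_eq_sum_digit_blocks:
  fixes n N :: "nat ^ 'd" and h :: "nat ^ 'd \<Rightarrow> 'b::comm_monoid_add"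
  assumes a: "a > 0" and nN: "\<And>s. n $ s < a ^ (N $ s + 1)"
  shows "(\<Sum>k\<in>{1..n}. h k) =
    (\<Sum>j\<in>{..N}. \<Sum>q\<in>digit_blocks a n j.
      \<Sum>k\<in>{(\<chi> s. q $ s * a ^ (j $ s)) + 1..(\<chi> s. q $ s * a ^ (j $ s)) + (\<chi> s. a ^ (j $ s))}. h k)"
proof -
  define R where "R = (\<lambda>m s j. j \<le> N $ s \<and> m div a ^ (j + 1) = n $ s div a ^ (j + 1) \<and>
    m div a ^ j < n $ s div a ^ j)"
  have ex1: "\<exists>!j. R m s j" if "m < n $ s" for m s
    using highest_differing_digit_ex1[OF that nN] by (simp add: R_def)
  define J where "J = (\<lambda>m s. THE j. R m s j)"
  have RJ: "R m s (J m s)" if "m < n $ s" for m s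
    unfolding J_def by (rule theI'[OF ex1[OF that]])
  have JR: "J m s = j" if "R m s j" "m < n $ s" for m s j
    unfolding J_def by (rule the1_equality[OF ex1[OF that(2)] that(1)])
  \<comment> \<open>\<open>g k\<close> consists of the level vector of \<open>k\<close> and the
    index of the block containing \<open>k\<close>; its fibres are the groups.\<close>
  define g where "g = (\<lambda>k :: nat ^ 'd. ((\<chi> s. J (k $ s - 1) s),
    (\<chi> s. (k $ s - 1) div a ^ J (k $ s - 1) s)))"
  have box: "k \<in> {1..n} \<longleftrightarrow> (\<forall>s. 1 \<le> k $ s \<and> k $ s - 1 < n $ s)" for k
  proof -
    have "(1 \<le> k $ s \<and> k $ s \<le> n $ s) = (1 \<le> k $ s \<and> k $ s - 1 < n $ s)" for s
      by auto
    then show ?thesis by (simp add: less_eq_vec_def) blast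
  qed
  define T where "T = (SIGMA j:{..N}. digit_blocks a n j)"
  have block: "k \<in> {(\<chi> s. q $ s * a ^ (j $ s)) + 1..(\<chi> s. q $ s * a ^ (j $ s)) + (\<chi> s. a ^ (j $ s))}
      \<longleftrightarrow> (\<forall>s. 1 \<le> k $ s \<and> (k $ s - 1) div a ^ (j $ s) = q $ s)" for k q j
  proof -
    have "(q $ s * a ^ (j $ s) + 1 \<le> k $ s \<and> k $ s \<le> q $ s * a ^ (j $ s) + a ^ (j $ s))
      \<longleftrightarrow> (1 \<le> k $ s \<and> (k $ s - 1) div a ^ (j $ s) = q $ s)" for s
      by (rule mem_block_iff) (use a in simp)
    then show ?thesis by (simp add: less_eq_vec_def) blast
  qed
  have "(\<Sum>k\<in>{1..n}. h k) = (\<Sum>y\<in>T. \<Sum>k\<in>{k \<in> {1..n}. g k = y}. h k)"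
  proof (rule sum.group[symmetric])
    show "finite T" unfolding T_def
      by (intro finite_SigmaI finite_atMost_vec finite_digit_blocks)
    show "g ` {1..n} \<subseteq> T"
    proof (rule image_subsetI)
      fix k assume "k \<in> {1..n}"
      then have "R (k $ s - 1) s (J (k $ s - 1) s)" for s
        using RJ[of "k $ s - 1" s] box[of k] by blast
      then show "g k \<in> T"
        by (auto simp: T_def g_def digit_blocks_def less_eq_vec_def R_def simp flip: div_mult2_eq)
           (simp add: mult.commute)
    qed
  qed (rule finite_atLeastAtMost_vec)
  also have "\<dots> = (\<Sum>(j, q)\<in>T. \<Sum>k\<in>{(\<chi> s. q $ s * a ^ (j $ s)) + 1..(\<chi> s. q $ s * a ^ (j $ s)) + (\<chi> s. a ^ (j $ s))}. h k)"
  proof (rule sum.cong[OF refl], clarify)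
    fix j q assume jq: "(j, q) \<in> T"
    have "k \<in> {1..n} \<and> g k = (j, q) \<longleftrightarrow> (\<forall>s. 1 \<le> k $ s \<and> (k $ s - 1) div a ^ (j $ s) = q $ s)" for k
    proof
      assume "k \<in> {1..n} \<and> g k = (j, q)"
      then show "\<forall>s. 1 \<le> k $ s \<and> (k $ s - 1) div a ^ (j $ s) = q $ s"
        using box[of k] by (auto simp: g_def)
    next
      assume k: "\<forall>s. 1 \<le> k $ s \<and> (k $ s - 1) div a ^ (j $ s) = q $ s"
      \<comment> \<open>On a block the quotient of \<open>k - 1\<close> is constantly
        \<open>q\<close>, and the conditions on \<open>q\<close> in \<open>digit_blocks\<close>
        together with \<open>j \<le> N\<close> are those of \<open>R\<close>. Uniqueness then forces
        \<open>j\<close> to be the level vector of every point of the block.\<close>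
      have R: "R (k $ s - 1) s (j $ s)" for s
      proof -
        have "(k $ s - 1) div a ^ (j $ s + 1) = q $ s div a"
          using k by (simp add: div_mult2_eq mult.commute[of a])
        then show ?thesis
          using jq k by (auto simp: T_def digit_blocks_def less_eq_vec_def R_def)
      qed
      have less: "k $ s - 1 < n $ s" for s
        using R[of s] div_le_mono[of "n $ s" "k $ s - 1" "a ^ (j $ s)"]
        by (auto simp: R_def not_le[symmetric])
      have "J (k $ s - 1) s = j $ s" for s
        by (rule JR[OF R less])
      then show "k \<in> {1..n} \<and> g k = (j, q)"
        using k less unfolding box by (simp add: g_def vec_eq_iff)
    qed
    then show "(\<Sum>k\<in>{k \<in> {1..n}. g k = (j, q)}. h k) =
      (\<Sum>k\<in>{(\<chi> s. q $ s * a ^ (j $ s)) + 1..(\<chi> s. q $ s * a ^ (j $ s)) + (\<chi> s. a ^ (j $ s))}. h k)"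
      using block by (intro sum.cong) blast+
  qed
  also have "\<dots> = (\<Sum>j\<in>{..N}. \<Sum>q\<in>digit_blocks a n j.
      \<Sum>k\<in>{(\<chi> s. q $ s * a ^ (j $ s)) + 1..(\<chi> s. q $ s * a ^ (j $ s)) + (\<chi> s. a ^ (j $ s))}. h k)"
    unfolding T_def by (rule sum.Sigma[symmetric]) (auto intro: finite_atMost_vec finite_digit_blocks)
  finally show ?thesis .
qed

section \<open>A Borel-Cantelli argument through expectations\<close>

text \<open>The sum of all \<open>Z i\<close> has finite integral, hence is finite almost
  everywhere, and a finite sum has only finitely many terms above a positive level. One null set
  serves all levels.\<close>

lemma AE_finite_superlevel_sets:
  fixes Z :: "'i::countable \<Rightarrow> 'a \<Rightarrow> ennreal"
  assumes [measurable]: "\<And>i. Z i \<in> borel_measurable M"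
    and bound: "\<And>F. finite F \<Longrightarrow> (\<Sum>i\<in>F. \<integral>\<^sup>+ \<omega>. Z i \<omega> \<partial>M) \<le> K" and K: "K < \<infinity>"
  shows "AE \<omega> in M. \<forall>\<epsilon>>0. finite {i. ennreal \<epsilon> \<le> Z i \<omega>}"
proof -
  \<comment> \<open>Extending the family by 0 to codes outside the range of \<open>to_nat\<close>
    turns it into a sequence, to which \<open>nn_integral_suminf\<close> applies.\<close>
  define g where "g = (\<lambda>n \<omega>. if n \<in> range (to_nat :: 'i \<Rightarrow> nat) then Z (from_nat n) \<omega> else 0)"
  have [measurable]: "g n \<in> borel_measurable M" for n
    unfolding g_def by (cases "n \<in> range (to_nat :: 'i \<Rightarrow> nat)") auto
  have "(\<integral>\<^sup>+ \<omega>. (\<Sum>n. g n \<omega>) \<partial>M) = (\<Sum>n. \<integral>\<^sup>+ \<omega>. g n \<omega> \<partial>M)"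
    by (rule nn_integral_suminf) simp
  also have "\<dots> \<le> K"
  proof (rule suminf_le_const)
    fix m
    have inj: "inj_on (to_nat :: 'i \<Rightarrow> nat) {i. to_nat i < m}"
      using inj_to_nat by (rule inj_on_subset) simp
    have fin: "finite {i :: 'i. to_nat i < m}"
      using finite_vimageI[OF finite_lessThan[of m] inj_to_nat] by (simp add: vimage_def)
    have "(\<Sum>n<m. \<integral>\<^sup>+ \<omega>. g n \<omega> \<partial>M) = (\<Sum>n\<in>to_nat ` {i :: 'i. to_nat i < m}. \<integral>\<^sup>+ \<omega>. g n \<omega> \<partial>M)"
    proof (rule sum.mono_neutral_right)
      have "n \<notin> range (to_nat :: 'i \<Rightarrow> nat)" if "n \<in> {..<m} - to_nat ` {i :: 'i. to_nat i < m}" for n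
        using that by auto
      then show "\<forall>n\<in>{..<m} - to_nat ` {i :: 'i. to_nat i < m}. (\<integral>\<^sup>+ \<omega>. g n \<omega> \<partial>M) = 0"
        by (simp add: g_def)
    qed auto
    also have "\<dots> = (\<Sum>i\<in>{i :: 'i. to_nat i < m}. \<integral>\<^sup>+ \<omega>. Z i \<omega> \<partial>M)"
      by (subst sum.reindex[OF inj]) (simp add: g_def)
    also have "\<dots> \<le> K" by (rule bound[OF fin])
    finally show "(\<Sum>n<m. \<integral>\<^sup>+ \<omega>. g n \<omega> \<partial>M) \<le> K" .
  qed simp
  finally have "(\<integral>\<^sup>+ \<omega>. (\<Sum>n. g n \<omega>) \<partial>M) \<noteq> \<infinity>" using K by auto
  then have "AE \<omega> in M. (\<Sum>n. g n \<omega>) \<noteq> \<infinity>"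
    by (rule nn_integral_PInf_AE[rotated]) simp
  then show ?thesis
  proof (rule AE_mp[OF _ AE_I2], intro impI allI)
    fix \<omega> and \<epsilon> :: real assume fin: "(\<Sum>n. g n \<omega>) \<noteq> \<infinity>" and "0 < \<epsilon>"
    show "finite {i. ennreal \<epsilon> \<le> Z i \<omega>}"
    proof (rule ccontr)
      assume inf: "infinite {i. ennreal \<epsilon> \<le> Z i \<omega>}"
      have "of_nat m * ennreal \<epsilon> \<le> (\<Sum>n. g n \<omega>)" for m
      proof -
        obtain A where A: "A \<subseteq> {i. ennreal \<epsilon> \<le> Z i \<omega>}" "finite A" "card A = m"
          using infinite_arbitrarily_large[OF inf] by blast
        have "of_nat m * ennreal \<epsilon> = (\<Sum>i\<in>A. ennreal \<epsilon>)" using A by simp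
        also have "\<dots> \<le> (\<Sum>i\<in>A. Z i \<omega>)" using A by (intro sum_mono) auto
        also have "\<dots> = (\<Sum>n\<in>to_nat ` A. g n \<omega>)"
          by (subst sum.reindex) (auto simp: g_def intro: inj_on_subset[OF inj_to_nat])
        also have "\<dots> \<le> (\<Sum>n. g n \<omega>)" using A by (intro sum_le_suminf) auto
        finally show ?thesis .
      qed
      moreover obtain r where r: "(\<Sum>n. g n \<omega>) = ennreal r" "0 \<le> r"
        using fin by (cases "\<Sum>n. g n \<omega>") auto
      ultimately have "real m * \<epsilon> \<le> r" for m
        using \<open>0 < \<epsilon>\<close> by (metis ennreal_le_iff ennreal_mult' ennreal_of_nat_eq_real_of_nat of_nat_0_le_iff)
      then show False
        using reals_Archimedean3[OF \<open>0 < \<epsilon>\<close>] by (metis not_le)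
    qed
  qed
qed

section \<open>Geometric series over levels and scales\<close>

lemma sum_power_diff_le:
  fixes \<theta> :: real
  assumes "0 \<le> \<theta>" "\<theta> < 1"
  shows "(\<Sum>j\<le>N. \<theta> ^ (N - j)) \<le> 1 / (1 - \<theta>)"
    and "(\<Sum>n\<in>{j..b}. \<theta> ^ (n - j)) \<le> 1 / (1 - \<theta>)"
proof -
  have geo: "(\<Sum>i\<in>A. \<theta> ^ i) \<le> 1 / (1 - \<theta>)" if "finite A" for A
  proof -
    have "(\<Sum>i\<in>A. \<theta> ^ i) \<le> (\<Sum>i. \<theta> ^ i)"
      using assms that by (intro sum_le_suminf summable_geometric) auto
    then show ?thesis using assms by (simp add: suminf_geometric)
  qed
  have "(\<Sum>j\<le>N. \<theta> ^ (N - j)) = (\<Sum>i\<le>N. \<theta> ^ i)"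
    by (rule sum.reindex_bij_witness[of _ "\<lambda>i. N - i" "\<lambda>i. N - i"]) auto
  then show "(\<Sum>j\<le>N. \<theta> ^ (N - j)) \<le> 1 / (1 - \<theta>)" using geo[of "{..N}"] by simp
  have "(\<Sum>n\<in>{j..b}. \<theta> ^ (n - j)) = (\<Sum>i\<in>(\<lambda>n. n - j) ` {j..b}. \<theta> ^ i)"
    by (subst sum.reindex) (auto simp: inj_on_def)
  then show "(\<Sum>n\<in>{j..b}. \<theta> ^ (n - j)) \<le> 1 / (1 - \<theta>)" using geo by simp
qed

text \<open>Both sums factor over the coordinates. The first, over levels below a fixed scale,
  serves the pathwise bound; the second, over scales above a fixed level, serves the
  expectations.\<close>

lemma sum_prod_power_diff_le:
  fixes \<theta> :: real and N j :: "nat ^ 'd"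
  assumes \<theta>: "0 \<le> \<theta>" "\<theta> < 1"
  shows "(\<Sum>j\<in>{..N}. \<Prod>s\<in>UNIV. \<theta> ^ (N $ s - j $ s)) \<le> (1 / (1 - \<theta>)) ^ CARD('d)"
    and "finite F \<Longrightarrow> (\<Sum>N\<in>{N \<in> F. j \<le> N}. \<Prod>s\<in>UNIV. \<theta> ^ (N $ s - j $ s)) \<le> (1 / (1 - \<theta>)) ^ CARD('d)"
proof -
  have "(\<Sum>j\<in>{..N}. \<Prod>s\<in>UNIV. \<theta> ^ (N $ s - j $ s)) = (\<Prod>s\<in>UNIV. \<Sum>i\<le>N $ s. \<theta> ^ (N $ s - i))"
    unfolding atMost_vec_eq by (rule sum_prod_vec_box) simp
  also have "\<dots> \<le> (\<Prod>s\<in>(UNIV :: 'd set). 1 / (1 - \<theta>))"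
    using \<theta> by (intro prod_mono conjI sum_nonneg sum_power_diff_le) auto
  finally show "(\<Sum>j\<in>{..N}. \<Prod>s\<in>UNIV. \<theta> ^ (N $ s - j $ s)) \<le> (1 / (1 - \<theta>)) ^ CARD('d)"
    by simp
next
  assume F: "finite F"
  \<comment> \<open>\<open>F\<close> need not be a product set; enclosing it in a box with upper
    bound \<open>b\<close> in every coordinate makes the sum factor.\<close>
  define b where "b = Max (insert 0 ((\<lambda>(N, s). N $ s) ` (F \<times> UNIV)))"
  have b: "N $ s \<le> b" if "N \<in> F" for N s
    unfolding b_def using F that by (intro Max_ge) (auto intro!: image_eqI[of _ _ "(N, s)"])
  have "(\<Sum>N\<in>{N \<in> F. j \<le> N}. \<Prod>s\<in>UNIV. \<theta> ^ (N $ s - j $ s))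
      \<le> (\<Sum>N\<in>{N. \<forall>s. N $ s \<in> {j $ s..b}}. \<Prod>s\<in>UNIV. \<theta> ^ (N $ s - j $ s))"
    using \<theta> b by (intro sum_mono2 finite_vec_box) (auto simp: less_eq_vec_def intro!: prod_nonneg)
  also have "\<dots> = (\<Prod>s\<in>UNIV. \<Sum>i\<in>{j $ s..b}. \<theta> ^ (i - j $ s))"
    by (rule sum_prod_vec_box) simp
  also have "\<dots> \<le> (\<Prod>s\<in>(UNIV :: 'd set). 1 / (1 - \<theta>))"
    using \<theta> by (intro prod_mono conjI sum_nonneg sum_power_diff_le) auto
  finally show "(\<Sum>N\<in>{N \<in> F. j \<le> N}. \<Prod>s\<in>UNIV. \<theta> ^ (N $ s - j $ s)) \<le> (1 / (1 - \<theta>)) ^ CARD('d)"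
    by simp
qed

section \<open>Pathwise bound for the normalised box sum\<close>

text \<open>In each coordinate, \<open>small\<close> allows growth by
  \<open>\<theta> / \<rho>\<close> per level below \<open>N\<close>, while replacing the normaliser
  of the block by that of \<open>n\<close> gains \<open>\<rho>\<close>. What remains is a geometric
  series in \<open>\<theta>\<close>; the power of \<open>a\<close> in the bound counts the blocks of
  one level.\<close>

lemma box_sum_le_of_block_sums_le:
  fixes n N :: "nat ^ 'd" and \<xi> :: "nat ^ 'd \<Rightarrow> 'a \<Rightarrow> real" and \<phi> :: "'d \<Rightarrow> real \<Rightarrow> real"
  assumes a: "a > 0" and N: "\<And>s. a ^ (N $ s) \<le> n $ s" "\<And>s. n $ s < a ^ (N $ s + 1)"
    and pos: "\<And>s x. x > 0 \<Longrightarrow> \<phi> s x > 0" and mono: "\<And>s. mono_on {0<..} (\<phi> s)"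
    and \<rho>: "\<rho> > 0"
    and decay: "\<And>s i k. i \<le> k \<Longrightarrow> \<phi> s (real (a ^ i)) \<le> \<rho> ^ (k - i) * \<phi> s (real (a ^ k))"
    and \<theta>: "0 < \<theta>" "\<theta> < 1" and "\<delta> \<ge> 0"
    and small: "\<And>j q. j \<le> N \<Longrightarrow> (\<And>s. q $ s < a ^ (N $ s + 1 - j $ s)) \<Longrightarrow>
      (\<Prod>s\<in>UNIV. (\<rho> / \<theta>) ^ (N $ s - j $ s)) *
        (\<bar>block_sum \<xi> (\<chi> s. q $ s * a ^ (j $ s)) (\<chi> s. a ^ (j $ s)) \<omega>\<bar> /
          (\<Prod>s\<in>UNIV. \<phi> s (real (a ^ (j $ s))))) \<le> \<delta>"
  shows "\<bar>(\<Sum>k\<in>{1..n}. \<xi> k \<omega>) / (\<Prod>s\<in>UNIV. \<phi> s (real (n $ s)))\<bar>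
    \<le> (real a / (1 - \<theta>)) ^ CARD('d) * \<delta>"
proof -
  define S where "S = (\<lambda>j q. block_sum \<xi> (\<chi> s. q $ s * a ^ (j $ s)) (\<chi> s. a ^ (j $ s)) \<omega>)"
  define \<Phi> where "\<Phi> = (\<Prod>s\<in>UNIV. \<phi> s (real (n $ s)))"
  have npos: "real (n $ s) > 0" for s
    using a N(1)[of s] by (metis less_le_trans of_nat_0_less_iff zero_less_power)
  have \<Phi>: "\<Phi> > 0" unfolding \<Phi>_def using npos by (intro prod_pos pos) auto
  have S: "\<bar>S j q\<bar> \<le> \<delta> * (\<Prod>s\<in>UNIV. \<theta> ^ (N $ s - j $ s)) * \<Phi>"
    if j: "j \<le> N" and q: "q \<in> digit_blocks a n j" for j q
  proof -
    define W where "W = (\<Prod>s\<in>UNIV. (\<rho> / \<theta>) ^ (N $ s - j $ s))"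
    define \<Psi> where "\<Psi> = (\<Prod>s\<in>UNIV. \<phi> s (real (a ^ (j $ s))))"
    have W: "W > 0" unfolding W_def using \<rho> \<theta> by (intro prod_pos) auto
    have \<Psi>: "\<Psi> > 0" unfolding \<Psi>_def using a by (intro prod_pos pos) auto
    \<comment> \<open>The blocks occurring for this \<open>n\<close> are among those covered by
      \<open>small\<close>, because \<open>n\<close> lies below \<open>a ^ (N + 1)\<close> in each
      coordinate.\<close>
    have "q $ s < a ^ (N $ s + 1 - j $ s)" for s
    proof -
      have "q $ s < n $ s div a ^ (j $ s)" using q by (simp add: digit_blocks_def)
      also have "\<dots> \<le> a ^ (N $ s + 1 - j $ s)"
      proof -
        have "n $ s \<le> a ^ (N $ s + 1 - j $ s) * a ^ (j $ s)"
          using N(2)[of s] j by (subst power_add[symmetric]) (simp add: less_eq_vec_def le_SucI)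
        from div_le_mono[OF this, of "a ^ (j $ s)"] show ?thesis using a by simp
      qed
      finally show ?thesis .
    qed
    from small[OF j this] have "W * (\<bar>S j q\<bar> / \<Psi>) \<le> \<delta>"
      by (simp add: S_def W_def \<Psi>_def)
    then have "\<bar>S j q\<bar> \<le> \<delta> / W * \<Psi>"
      using W \<Psi> by (simp add: field_simps)
    \<comment> \<open>\<open>decay\<close> leads from level \<open>j\<close> up to \<open>N\<close>,
      and monotonicity from \<open>a ^ N\<close> to \<open>n\<close>.\<close>
    also have "\<dots> \<le> \<delta> / W * ((\<Prod>s\<in>UNIV. \<rho> ^ (N $ s - j $ s)) * \<Phi>)"
    proof (rule mult_left_mono)
      have "\<phi> s (real (a ^ (j $ s))) \<le> \<rho> ^ (N $ s - j $ s) * \<phi> s (real (n $ s))" for s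
      proof -
        have "\<phi> s (real (a ^ (N $ s))) \<le> \<phi> s (real (n $ s))"
          using N(1)[of s] a npos[of s] by (intro mono_onD[OF mono]) (auto simp del: of_nat_power)
        then have "\<rho> ^ (N $ s - j $ s) * \<phi> s (real (a ^ (N $ s))) \<le> \<rho> ^ (N $ s - j $ s) * \<phi> s (real (n $ s))"
          using \<rho> by (intro mult_left_mono) auto
        moreover have "j $ s \<le> N $ s" using j by (simp add: less_eq_vec_def)
        ultimately show ?thesis using decay[of "j $ s" "N $ s" s] by linarith
      qed
      then have "\<Psi> \<le> (\<Prod>s\<in>UNIV. \<rho> ^ (N $ s - j $ s) * \<phi> s (real (n $ s)))"
        unfolding \<Psi>_def using a by (intro prod_mono) (auto intro!: less_imp_le pos)
      then show "\<Psi> \<le> (\<Prod>s\<in>UNIV. \<rho> ^ (N $ s - j $ s)) * \<Phi>"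
        by (simp add: prod.distrib \<Phi>_def)
      show "0 \<le> \<delta> / W" using W \<open>\<delta> \<ge> 0\<close> by simp
    qed
    also have "\<dots> = \<delta> * (\<Prod>s\<in>UNIV. \<theta> ^ (N $ s - j $ s)) * \<Phi>"
    proof -
      have "(\<Prod>s\<in>UNIV. \<rho> ^ (N $ s - j $ s)) = W * (\<Prod>s\<in>UNIV. \<theta> ^ (N $ s - j $ s))"
        unfolding W_def prod.distrib[symmetric] using \<theta> by (intro prod.cong) (auto simp: power_divide)
      then show ?thesis using W by simp
    qed
    finally show ?thesis .
  qed
  have "(\<Sum>k\<in>{1..n}. \<xi> k \<omega>) = (\<Sum>j\<in>{..N}. \<Sum>q\<in>digit_blocks a n j. S j q)"
    unfolding S_def block_sum_def by (rule sum_box_eq_sum_digit_blocks[OF a N(2)])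
  then have "\<bar>\<Sum>k\<in>{1..n}. \<xi> k \<omega>\<bar> \<le> (\<Sum>j\<in>{..N}. \<Sum>q\<in>digit_blocks a n j. \<bar>S j q\<bar>)"
    by (auto intro!: order_trans[OF sum_abs] sum_mono)
  also have "\<dots> \<le> (\<Sum>j\<in>{..N}. real a ^ CARD('d) * (\<delta> * (\<Prod>s\<in>UNIV. \<theta> ^ (N $ s - j $ s)) * \<Phi>))"
  proof (rule sum_mono)
    fix j assume "j \<in> {..N}"
    then have "(\<Sum>q\<in>digit_blocks a n j. \<bar>S j q\<bar>)
        \<le> real (card (digit_blocks a n j)) * (\<delta> * (\<Prod>s\<in>UNIV. \<theta> ^ (N $ s - j $ s)) * \<Phi>)"
      using S by (intro sum_bounded_above) auto
    also have "\<dots> \<le> real a ^ CARD('d) * (\<delta> * (\<Prod>s\<in>UNIV. \<theta> ^ (N $ s - j $ s)) * \<Phi>)"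
    proof (rule mult_right_mono)
      show "real (card (digit_blocks a n j)) \<le> real a ^ CARD('d)"
        using card_digit_blocks_le[OF a, of n j] by (metis of_nat_le_iff of_nat_power)
      show "0 \<le> \<delta> * (\<Prod>s\<in>UNIV. \<theta> ^ (N $ s - j $ s)) * \<Phi>"
        using \<Phi> \<theta> \<open>\<delta> \<ge> 0\<close> by (intro mult_nonneg_nonneg prod_nonneg) auto
    qed
    finally show "(\<Sum>q\<in>digit_blocks a n j. \<bar>S j q\<bar>)
        \<le> real a ^ CARD('d) * (\<delta> * (\<Prod>s\<in>UNIV. \<theta> ^ (N $ s - j $ s)) * \<Phi>)" .
  qed
  also have "\<dots> = real a ^ CARD('d) * \<delta> * \<Phi> * (\<Sum>j\<in>{..N}. \<Prod>s\<in>UNIV. \<theta> ^ (N $ s - j $ s))"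
    by (simp add: sum_distrib_left mult_ac)
  also have "\<dots> \<le> real a ^ CARD('d) * \<delta> * \<Phi> * (1 / (1 - \<theta>)) ^ CARD('d)"
    using \<Phi> \<theta> \<open>\<delta> \<ge> 0\<close> by (intro mult_left_mono sum_prod_power_diff_le) auto
  also have "\<dots> = (real a / (1 - \<theta>)) ^ CARD('d) * \<delta> * \<Phi>"
    by (simp add: power_divide)
  finally show ?thesis
    using \<Phi> by (simp add: \<Phi>_def[symmetric] abs_divide pos_divide_le_eq)
qed

section \<open>Growth of the normalising functions\<close>

text \<open>Multiplying the argument by \<open>a\<close> includes at least \<open>L\<close>
  doublings, each gaining a factor \<open>C\<close>; monotonicity covers the rest of the way from
  \<open>2 ^ L * x\<close> to \<open>a * x\<close>. Iterating \<open>k - i\<close> times gives the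
  bound.\<close>

lemma geometric_decay_of_doubling:
  fixes f :: "real \<Rightarrow> real" and C :: real
  assumes pos: "\<And>x. x > 0 \<Longrightarrow> f x > 0" and mono: "mono_on {0<..} f"
    and doubling: "\<And>x. x > 0 \<Longrightarrow> C < f (2 * x) / f x" and C: "C > 0"
    and a: "2 ^ L \<le> a" and ik: "i \<le> k"
  shows "f (real (a ^ i)) \<le> (1 / C ^ L) ^ (k - i) * f (real (a ^ k))"
proof -
  have two: "C ^ l * f x \<le> f (2 ^ l * x)" if "x > 0" for l x
  proof (induction l)
    case (Suc l)
    have "C ^ Suc l * f x \<le> C * f (2 ^ l * x)"
      using Suc C by simp
    also have "\<dots> \<le> f (2 * (2 ^ l * x))"
      using doubling[of "2 ^ l * x"] pos[of "2 ^ l * x"] \<open>x > 0\<close> by (simp add: field_simps)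
    finally show ?case by (simp add: mult_ac)
  qed simp
  have "0 < (2::nat) ^ L" by simp
  then have a0: "a > 0" using a by linarith
  have step: "C ^ L * f x \<le> f (real a * x)" if "x > 0" for x
  proof -
    have "(2::real) ^ L \<le> real a" using a by (metis of_nat_le_iff of_nat_numeral of_nat_power)
    then have "f (2 ^ L * x) \<le> f (real a * x)"
      using that a0 by (intro mono_onD[OF mono]) auto
    then show ?thesis using two[OF that, of L] by simp
  qed
  have "(C ^ L) ^ m * f (real (a ^ i)) \<le> f (real (a ^ (i + m)))" for m
  proof (induction m)
    case (Suc m)
    have "(C ^ L) ^ Suc m * f (real (a ^ i)) \<le> C ^ L * f (real (a ^ (i + m)))"
      using Suc C by (simp add: mult_left_mono mult.assoc)
    also have "\<dots> \<le> f (real a * real (a ^ (i + m)))"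
      using a0 by (intro step) simp
    finally show ?case by simp
  qed simp
  from this[of "k - i"] ik show ?thesis
    using C by (simp add: power_divide field_simps)
qed

section \<open>Summability of the expectations\<close>

text \<open>The number of blocks grows by a factor \<open>a\<close> per level and coordinate, which
  the weight \<open>\<eta>\<close> outweighs. After exchanging the order of summation, each
  \<open>\<beta> j\<close> is multiplied by a geometric series of ratio \<open>\<eta> * a\<close>
  over the scales \<open>N \<ge> j\<close>.\<close>

lemma sum_expectation_block_sums_le:
  fixes X :: "nat ^ 'd \<Rightarrow> nat ^ 'd \<Rightarrow> 'a \<Rightarrow> ennreal"
  assumes [measurable]: "\<And>j q. X j q \<in> borel_measurable M"
    and X: "\<And>j q. (\<integral>\<^sup>+ \<omega>. X j q \<omega> \<partial>M) \<le> \<beta> j"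
    and B: "\<And>F. finite F \<Longrightarrow> (\<Sum>j\<in>F. \<beta> j) \<le> B"
    and \<eta>: "0 \<le> \<eta>" "\<eta> * real a < 1" and F: "finite F"
  shows "(\<Sum>N\<in>F. \<integral>\<^sup>+ \<omega>. (\<Sum>j\<in>{..N}. \<Sum>q\<in>{q. \<forall>s. q $ s \<in> {..<a ^ (N $ s + 1 - j $ s)}}.
      ennreal (\<Prod>s\<in>UNIV. \<eta> ^ (N $ s - j $ s)) * X j q \<omega>) \<partial>M)
    \<le> ennreal ((real a / (1 - \<eta> * real a)) ^ CARD('d)) * B"
proof -
  let ?Q = "\<lambda>N j :: nat ^ 'd. {q :: nat ^ 'd. \<forall>s. q $ s \<in> {..<a ^ (N $ s + 1 - j $ s)}}"
  define \<kappa> where "\<kappa> = \<eta> * real a"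
  have \<kappa>: "0 \<le> \<kappa>" "\<kappa> < 1" using \<eta> by (auto simp: \<kappa>_def)
  define w where "w = (\<lambda>N j :: nat ^ 'd. \<Prod>s\<in>UNIV. \<kappa> ^ (N $ s - j $ s))"
  have w: "w N j \<ge> 0" for N j unfolding w_def using \<kappa> by (intro prod_nonneg) auto
  have "(\<integral>\<^sup>+ \<omega>. (\<Sum>j\<in>{..N}. \<Sum>q\<in>?Q N j. ennreal (\<Prod>s\<in>UNIV. \<eta> ^ (N $ s - j $ s)) * X j q \<omega>) \<partial>M)
      \<le> (\<Sum>j\<in>{..N}. ennreal (real a ^ CARD('d) * w N j) * \<beta> j)" for N
  proof -
    have "(\<integral>\<^sup>+ \<omega>. (\<Sum>j\<in>{..N}. \<Sum>q\<in>?Q N j. ennreal (\<Prod>s\<in>UNIV. \<eta> ^ (N $ s - j $ s)) * X j q \<omega>) \<partial>M)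
      = (\<Sum>j\<in>{..N}. \<Sum>q\<in>?Q N j. ennreal (\<Prod>s\<in>UNIV. \<eta> ^ (N $ s - j $ s)) * (\<integral>\<^sup>+ \<omega>. X j q \<omega> \<partial>M))"
      by (simp add: nn_integral_sum nn_integral_cmult)
    also have "\<dots> \<le> (\<Sum>j\<in>{..N}. \<Sum>q\<in>?Q N j. ennreal (\<Prod>s\<in>UNIV. \<eta> ^ (N $ s - j $ s)) * \<beta> j)"
      using X by (intro sum_mono mult_left_mono) auto
    also have "\<dots> = (\<Sum>j\<in>{..N}. ennreal (real a ^ CARD('d) * w N j) * \<beta> j)"
    proof (rule sum.cong[OF refl])
      fix j assume "j \<in> {..N}"
      then have j: "j $ s \<le> N $ s" for s by (simp add: less_eq_vec_def)
      \<comment> \<open>The exponent is \<open>N + 1 - j\<close>, one more than in the weight; the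
        surplus factor \<open>a\<close> in each coordinate is the source of
        \<open>a ^ CARD('d)\<close>.\<close>
      have "card (?Q N j) = (\<Prod>s\<in>UNIV. a ^ (N $ s + 1 - j $ s))"
        by (subst card_vec_box) simp_all
      also have "\<dots> = a ^ CARD('d) * (\<Prod>s\<in>UNIV. a ^ (N $ s - j $ s))"
        using j by (simp add: Suc_diff_le prod.distrib)
      finally have "real (card (?Q N j)) * (\<Prod>s\<in>UNIV. \<eta> ^ (N $ s - j $ s)) = real a ^ CARD('d) * w N j"
        by (simp add: w_def \<kappa>_def power_mult_distrib prod.distrib)
      moreover have "0 \<le> (\<Prod>s\<in>UNIV. \<eta> ^ (N $ s - j $ s))"
        using \<eta> by (intro prod_nonneg) auto
      ultimately have "of_nat (card (?Q N j)) * ennreal (\<Prod>s\<in>UNIV. \<eta> ^ (N $ s - j $ s))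
          = ennreal (real a ^ CARD('d) * w N j)"
        by (simp only: ennreal_of_nat_eq_real_of_nat ennreal_mult[symmetric] of_nat_0_le_iff)
      then show "(\<Sum>q\<in>?Q N j. ennreal (\<Prod>s\<in>UNIV. \<eta> ^ (N $ s - j $ s)) * \<beta> j)
          = ennreal (real a ^ CARD('d) * w N j) * \<beta> j"
        by (simp only: sum_constant mult.assoc[symmetric])
    qed
    finally show ?thesis .
  qed
  then have "(\<Sum>N\<in>F. \<integral>\<^sup>+ \<omega>. (\<Sum>j\<in>{..N}. \<Sum>q\<in>?Q N j. ennreal (\<Prod>s\<in>UNIV. \<eta> ^ (N $ s - j $ s)) * X j q \<omega>) \<partial>M)
      \<le> (\<Sum>N\<in>F. \<Sum>j\<in>{..N}. ennreal (real a ^ CARD('d) * w N j) * \<beta> j)"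
    by (rule sum_mono)
  \<comment> \<open>Writing the levels as a restriction of one common finite set prepares the
    exchange by \<open>sum.swap_restrict\<close>.\<close>
  also have "\<dots> = (\<Sum>N\<in>F. \<Sum>j\<in>{j \<in> (\<Union>N\<in>F. {..N}). j \<le> N}. ennreal (real a ^ CARD('d) * w N j) * \<beta> j)"
    by (intro sum.cong refl) auto
  also have "\<dots> = (\<Sum>j\<in>(\<Union>N\<in>F. {..N}). \<Sum>N\<in>{N \<in> F. j \<le> N}. ennreal (real a ^ CARD('d) * w N j) * \<beta> j)"
    using F by (intro sum.swap_restrict) (auto intro: finite_atMost_vec)
  also have "\<dots> \<le> (\<Sum>j\<in>(\<Union>N\<in>F. {..N}). ennreal ((real a / (1 - \<kappa>)) ^ CARD('d)) * \<beta> j)"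
  proof (rule sum_mono)
    fix j
    have "(\<Sum>N\<in>{N \<in> F. j \<le> N}. ennreal (real a ^ CARD('d) * w N j) * \<beta> j)
        = ennreal (\<Sum>N\<in>{N \<in> F. j \<le> N}. real a ^ CARD('d) * w N j) * \<beta> j"
      using w by (simp add: sum_distrib_right[symmetric] sum_ennreal)
    also have "\<dots> \<le> ennreal ((real a / (1 - \<kappa>)) ^ CARD('d)) * \<beta> j"
    proof (intro mult_right_mono ennreal_leI)
      have "(\<Sum>N\<in>{N \<in> F. j \<le> N}. w N j) \<le> (1 / (1 - \<kappa>)) ^ CARD('d)"
        unfolding w_def by (rule sum_prod_power_diff_le(2)[OF \<kappa> F])
      then have "real a ^ CARD('d) * (\<Sum>N\<in>{N \<in> F. j \<le> N}. w N j) \<le> real a ^ CARD('d) * (1 / (1 - \<kappa>)) ^ CARD('d)"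
        by (intro mult_left_mono) auto
      then show "(\<Sum>N\<in>{N \<in> F. j \<le> N}. real a ^ CARD('d) * w N j) \<le> (real a / (1 - \<kappa>)) ^ CARD('d)"
        by (simp add: sum_distrib_left power_divide)
    qed simp
    finally show "(\<Sum>N\<in>{N \<in> F. j \<le> N}. ennreal (real a ^ CARD('d) * w N j) * \<beta> j)
        \<le> ennreal ((real a / (1 - \<kappa>)) ^ CARD('d)) * \<beta> j" .
  qed
  also have "\<dots> = ennreal ((real a / (1 - \<kappa>)) ^ CARD('d)) * (\<Sum>j\<in>(\<Union>N\<in>F. {..N}). \<beta> j)"
    by (simp add: sum_distrib_left)
  also have "\<dots> \<le> ennreal ((real a / (1 - \<kappa>)) ^ CARD('d)) * B"
    using F by (intro mult_left_mono B) (auto intro: finite_atMost_vec)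
  finally show ?thesis unfolding \<kappa>_def .
qed

section \<open>Base-\<open>a\<close> scales and the filter at infinity\<close>

text \<open>Positive coordinates each have a scale. If the largest coordinate is at least
  \<open>b\<close>, its scale exceeds that of every member of \<open>F\<close> in this coordinate,
  so the scale vector is not in \<open>F\<close> even if the other coordinates stay small.\<close>

lemma eventually_at_max_norm_infinity_outside_scales:
  fixes F :: "(nat ^ 'd) set"
  assumes a: "a \<ge> 2" and F: "finite F"
  shows "\<forall>\<^sub>F n :: nat ^ 'd in at_max_norm_infinity.
    \<exists>N. N \<notin> F \<and> (\<forall>s. a ^ (N $ s) \<le> n $ s \<and> n $ s < a ^ (N $ s + 1))"
proof -
  define b where "b = Max (insert 0 ((\<lambda>(N, s). a ^ (N $ s + 1)) ` (F \<times> UNIV)))"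
  have b: "a ^ (N $ s + 1) \<le> b" if "N \<in> F" for N s
    unfolding b_def using F that by (intro Max_ge) (auto intro!: image_eqI[of _ _ "(N, s)"])
  have "\<exists>N. N \<notin> F \<and> (\<forall>s. a ^ (N $ s) \<le> n $ s \<and> n $ s < a ^ (N $ s + 1))"
    if n: "b \<le> max_norm n" "\<forall>s. 1 \<le> n $ s" for n
  proof -
    have "\<forall>s. \<exists>m. a ^ m \<le> n $ s \<and> n $ s < a ^ (m + 1)"
      using ex_power_ivl1[OF a] n(2) by blast
    then obtain m where m: "\<And>s. a ^ m s \<le> n $ s \<and> n $ s < a ^ (m s + 1)" by metis
    have "max_norm n \<in> range (\<lambda>s. n $ s)"
      unfolding max_norm_def by (intro Max_in) auto
    then obtain s where "max_norm n = n $ s" by auto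
    then have "b < a ^ (m s + 1)" using n(1) m[of s] by linarith
    then have "vec_lambda m \<notin> F" using b[of "vec_lambda m" s] by auto
    then show ?thesis using m by (intro exI[of _ "vec_lambda m"]) auto
  qed
  moreover have "\<forall>\<^sub>F n :: nat ^ 'd in filtercomap max_norm at_top. b \<le> max_norm n"
    by (intro eventually_filtercomapI eventually_ge_at_top)
  ultimately show ?thesis
    unfolding at_max_norm_infinity_def eventually_inf_principal
    by (auto elim!: eventually_mono)
qed

section \<open>From summable expectations to almost sure convergence\<close>

lemma finite_sum_le_infsum_ennreal:
  fixes f :: "'i \<Rightarrow> ennreal"
  assumes "finite F"
  shows "sum f F \<le> (\<Sum>\<^sub>\<infinity>i. f i)"
  using assms by (subst nonneg_infsum_complete) (auto intro!: SUP_upper)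

theorem theorem1p2:
  fixes M :: "'a measure"
    and \<xi> :: "nat ^ 'd \<Rightarrow> 'a \<Rightarrow> real"
    and \<phi> :: "'d \<Rightarrow> real \<Rightarrow> real"
    and p C\<^sub>3 C\<^sub>4 :: real
    and a :: nat
  assumes "prob_space M"
    and "\<And>n. \<xi> n \<in> borel_measurable M"
    and "p > 0"
    and "\<And>s x. x > 0 \<Longrightarrow> \<phi> s x > 0"
    and "\<And>s. mono_on {0<..} (\<phi> s)"
    and "1 < C\<^sub>3" and "C\<^sub>3 \<le> C\<^sub>4"
    and "\<And>s x. x > 0 \<Longrightarrow> C\<^sub>3 < \<phi> s (2 * x) / \<phi> s x \<and> \<phi> s (2 * x) / \<phi> s x < C\<^sub>4"
    and "a \<ge> 2"
    and "C\<^sub>3 powr (p * of_int \<lfloor>log 2 (real a)\<rfloor>) > max (real a) (real a * 2 powr (p - 1))"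
    and "(\<Sum>\<^sub>\<infinity>n\<in>(UNIV :: (nat ^ 'd) set). SUP m :: nat ^ 'd.
            \<integral>\<^sup>+ \<omega>. ennreal (\<bar>block_sum \<xi> m (\<chi> s. a ^ (n $ s)) \<omega>\<bar> powr p
                     / (\<Prod>s\<in>UNIV. \<phi> s (real (a ^ (n $ s))) powr p)) \<partial>M) < \<infinity>"
  shows "AE \<omega> in M. ((\<lambda>n :: nat ^ 'd. (\<Sum>k\<in>{1..n}. \<xi> k \<omega>) / (\<Prod>s\<in>UNIV. \<phi> s (real (n $ s))))
            \<longlongrightarrow> 0) at_max_norm_infinity"
proof -
  note [measurable] = assms(2)
  note p = \<open>p > 0\<close> and pos = assms(4) and mono = assms(5) and a = \<open>a \<ge> 2\<close>
  \<comment> \<open>\<open>2 ^ L\<close> is the largest power of two not exceeding \<open>a\<close>;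
    \<open>nat\<close> loses nothing, since \<open>a \<ge> 2\<close> makes the floor
    nonnegative.\<close>
  define L where "L = nat \<lfloor>log 2 (real a)\<rfloor>"
  have L: "real L = of_int \<lfloor>log 2 (real a)\<rfloor>"
    using a by (simp add: L_def)
  have "2 powr real L \<le> real a"
    using a by (simp add: L flip: le_log_iff)
  then have La: "2 ^ L \<le> a"
    by (simp add: powr_realpow)
  define \<rho> where "\<rho> = 1 / C\<^sub>3 ^ L"
  have \<rho>: "\<rho> > 0" using \<open>1 < C\<^sub>3\<close> by (simp add: \<rho>_def)
  have \<rho>p: "\<rho> powr p = 1 / C\<^sub>3 powr (p * real L)"
    using \<open>1 < C\<^sub>3\<close> by (simp add: \<rho>_def powr_divide powr_powr mult.commute flip: powr_realpow)
  have decay: "\<phi> s (real (a ^ i)) \<le> \<rho> ^ (k - i) * \<phi> s (real (a ^ k))" if "i \<le> k" for s i k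
    unfolding \<rho>_def using assms(8)[of _ s] \<open>1 < C\<^sub>3\<close>
    by (intro geometric_decay_of_doubling pos mono La that) auto
  \<comment> \<open>Any \<open>\<theta>\<close> strictly between \<open>\<rho> a\<^bsup>1/p\<^esup>\<close> and 1 makes both geometric series converge: ratio \<open>\<theta>\<close>
    for the pathwise bound, ratio \<open>\<eta> a\<close> for the expectations.\<close>
  define t where "t = \<rho> * real a powr (1 / p)"
  have t0: "t > 0" using \<rho> a by (simp add: t_def)
  have tp: "t powr p = \<rho> powr p * real a"
    using \<rho> a p by (simp add: t_def powr_mult powr_powr)
  \<comment> \<open>The growth hypothesis gives \<open>a < C\<^sub>3 powr (p * L)\<close>, that is,
    \<open>\<rho> powr p * a < 1\<close>.\<close>
  have "t powr p < 1"
    unfolding tp \<rho>p using assms(10) \<open>1 < C\<^sub>3\<close> by (simp add: L)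
  then have t1: "t < 1"
    using p t0 by (metis le_less_linear ge_one_powr_ge_zero less_imp_le not_le)
  \<comment> \<open>With \<open>t\<close> equal to the square of \<open>\<theta>\<close>, the ratio
    \<open>\<eta> * a = t powr p / \<theta> powr p\<close> becomes
    \<open>\<theta> powr p\<close>.\<close>
  define \<theta> where "\<theta> = sqrt t"
  have \<theta>: "0 < \<theta>" "\<theta> < 1" using t0 t1 by (auto simp: \<theta>_def)
  define \<eta> where "\<eta> = (\<rho> / \<theta>) powr p"
  have \<eta>: "0 \<le> \<eta>" by (simp add: \<eta>_def)
  have "\<eta> * real a = t powr p / \<theta> powr p"
    using \<rho> \<theta> by (simp add: \<eta>_def tp powr_divide)
  also have "\<dots> = \<theta> powr p"
  proof -
    have "t powr p = \<theta> powr p * \<theta> powr p"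
      using t0 by (simp add: \<theta>_def flip: powr_mult)
    then show ?thesis using \<theta> by simp
  qed
  also have "\<dots> < 1" using \<theta> p powr_less_mono2[of p \<theta> 1] by simp
  finally have \<eta>a: "\<eta> * real a < 1" .

  define \<beta> where "\<beta> = (\<lambda>n :: nat ^ 'd. SUP m :: nat ^ 'd.
            \<integral>\<^sup>+ \<omega>. ennreal (\<bar>block_sum \<xi> m (\<chi> s. a ^ (n $ s)) \<omega>\<bar> powr p
                     / (\<Prod>s\<in>UNIV. \<phi> s (real (a ^ (n $ s))) powr p)) \<partial>M)"
  define X where "X = (\<lambda>j q :: nat ^ 'd. \<lambda>\<omega>.
    ennreal (\<bar>block_sum \<xi> (\<chi> s. q $ s * a ^ (j $ s)) (\<chi> s. a ^ (j $ s)) \<omega>\<bar> powr p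
                     / (\<Prod>s\<in>UNIV. \<phi> s (real (a ^ (j $ s))) powr p)))"
  have [measurable]: "X j q \<in> borel_measurable M" for j q
    unfolding X_def block_sum_def by measurable
  have X: "(\<integral>\<^sup>+ \<omega>. X j q \<omega> \<partial>M) \<le> \<beta> j" for j q
    unfolding X_def \<beta>_def by (rule SUP_upper) simp
  \<comment> \<open>All aligned blocks in the large box enter, not only those of one particular
    \<open>n\<close>, so a single \<open>Z N\<close> controls every \<open>n\<close> of scale
    \<open>N\<close>.\<close>
  define Z where "Z = (\<lambda>N :: nat ^ 'd. \<lambda>\<omega>.
    \<Sum>j\<in>{..N}. \<Sum>q\<in>{q. \<forall>s. q $ s \<in> {..<a ^ (N $ s + 1 - j $ s)}}.
      ennreal (\<Prod>s\<in>UNIV. \<eta> ^ (N $ s - j $ s)) * X j q \<omega>)"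
  have "AE \<omega> in M. \<forall>\<epsilon>>0. finite {N. ennreal \<epsilon> \<le> Z N \<omega>}"
  proof (rule AE_finite_superlevel_sets)
    show "Z N \<in> borel_measurable M" for N unfolding Z_def by measurable
    show "(\<Sum>N\<in>F. \<integral>\<^sup>+ \<omega>. Z N \<omega> \<partial>M)
        \<le> ennreal ((real a / (1 - \<eta> * real a)) ^ CARD('d)) * (\<Sum>\<^sub>\<infinity>n. \<beta> n)" if "finite F" for F
      unfolding Z_def
      by (rule sum_expectation_block_sums_le[OF _ X finite_sum_le_infsum_ennreal \<eta> \<eta>a that]) simp
    show "ennreal ((real a / (1 - \<eta> * real a)) ^ CARD('d)) * (\<Sum>\<^sub>\<infinity>n. \<beta> n) < \<infinity>"
      using assms(11) by (simp add: ennreal_mult_less_top \<beta>_def)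
  qed
  then show ?thesis
  proof (rule AE_mp[OF _ AE_I2], intro impI)
    fix \<omega> assume fin: "\<forall>\<epsilon>>0. finite {N. ennreal \<epsilon> \<le> Z N \<omega>}"
    define K where "K = (real a / (1 - \<theta>)) ^ CARD('d)"
    have K: "K > 0" unfolding K_def using a \<theta> by (intro zero_less_power divide_pos_pos) auto
    show "((\<lambda>n :: nat ^ 'd. (\<Sum>k\<in>{1..n}. \<xi> k \<omega>) / (\<Prod>s\<in>UNIV. \<phi> s (real (n $ s))))
            \<longlongrightarrow> 0) at_max_norm_infinity"
    proof (rule tendstoI)
      fix e :: real assume "0 < e"
      \<comment> \<open>Then \<open>K * \<delta> = e / 2\<close>, which turns the non-strict
        pathwise bound into a strict one.\<close>
      define \<delta> where "\<delta> = e / (2 * K)"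
      have \<delta>: "\<delta> > 0" using \<open>0 < e\<close> K by (simp add: \<delta>_def)
      have "finite {N. ennreal (\<delta> powr p) \<le> Z N \<omega>}"
        using fin \<delta> by simp
      from eventually_at_max_norm_infinity_outside_scales[OF a this]
      show "\<forall>\<^sub>F n in at_max_norm_infinity.
        dist ((\<Sum>k\<in>{1..n}. \<xi> k \<omega>) / (\<Prod>s\<in>UNIV. \<phi> s (real (n $ s)))) 0 < e"
      proof (rule eventually_mono)
        fix n assume "\<exists>N. N \<notin> {N. ennreal (\<delta> powr p) \<le> Z N \<omega>} \<and>
          (\<forall>s. a ^ (N $ s) \<le> n $ s \<and> n $ s < a ^ (N $ s + 1))"
        then obtain N where ZN: "Z N \<omega> < ennreal (\<delta> powr p)"
          and N: "\<And>s. a ^ (N $ s) \<le> n $ s" "\<And>s. n $ s < a ^ (N $ s + 1)"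
          by (auto simp: not_le)
        have "\<bar>(\<Sum>k\<in>{1..n}. \<xi> k \<omega>) / (\<Prod>s\<in>UNIV. \<phi> s (real (n $ s)))\<bar> \<le> K * \<delta>"
          unfolding K_def
        proof (rule box_sum_le_of_block_sums_le[OF _ N pos mono \<rho> decay \<theta>])
          fix j q :: "nat ^ 'd"
          assume j: "j \<le> N" and q: "\<And>s. q $ s < a ^ (N $ s + 1 - j $ s)"
          define W where "W = (\<Prod>s\<in>UNIV. (\<rho> / \<theta>) ^ (N $ s - j $ s))"
          define Y where "Y = \<bar>block_sum \<xi> (\<chi> s. q $ s * a ^ (j $ s)) (\<chi> s. a ^ (j $ s)) \<omega>\<bar>"
          define \<Psi> where "\<Psi> = (\<Prod>s\<in>UNIV. \<phi> s (real (a ^ (j $ s))))"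
          have W: "W > 0" unfolding W_def using \<rho> \<theta> by (intro prod_pos) auto
          have \<Psi>: "\<Psi> > 0" unfolding \<Psi>_def using a by (intro prod_pos pos) auto
          \<comment> \<open>Only the domination of one nonnegative term by the whole sum is used, so
            no inequality for \<open>p\<close>-th powers of sums enters and \<open>p\<close> may lie
            on either side of 1.\<close>
          have "ennreal (\<Prod>s\<in>UNIV. \<eta> ^ (N $ s - j $ s)) * X j q \<omega>
            \<le> (\<Sum>q\<in>{q. \<forall>s. q $ s \<in> {..<a ^ (N $ s + 1 - j $ s)}}.
                ennreal (\<Prod>s\<in>UNIV. \<eta> ^ (N $ s - j $ s)) * X j q \<omega>)"
            using q by (intro member_le_sum finite_vec_box) auto
          also have "\<dots> \<le> Z N \<omega>"
            unfolding Z_def using j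
            by (intro member_le_sum[where f = "\<lambda>j. \<Sum>q\<in>_ j. _ j q"] finite_atMost_vec) auto
          also note ZN
          finally have "ennreal (\<Prod>s\<in>UNIV. \<eta> ^ (N $ s - j $ s)) * X j q \<omega> < ennreal (\<delta> powr p)" .
          moreover have "(\<Prod>s\<in>UNIV. \<eta> ^ (N $ s - j $ s)) = W powr p"
            unfolding W_def using \<rho> \<theta>
            by (simp add: \<eta>_def prod_powr_distrib powr_powr mult.commute flip: powr_realpow)
          moreover have "X j q \<omega> = ennreal ((Y / \<Psi>) powr p)"
            using \<Psi> by (simp add: X_def Y_def \<Psi>_def powr_divide prod_powr_distrib)
          ultimately have "(W * (Y / \<Psi>)) powr p < \<delta> powr p"
            by (simp add: powr_mult[of W "Y / \<Psi>"] ennreal_mult[symmetric] ennreal_less_iff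
                del: times_divide_eq_right)
          \<comment> \<open>The \<open>p\<close>-th root is taken by contraposition of the
            monotonicity of \<open>powr\<close>.\<close>
          then have "W * (Y / \<Psi>) \<le> \<delta>"
            using powr_mono2[of p \<delta> "W * (Y / \<Psi>)"] p \<delta> by linarith
          then show "(\<Prod>s\<in>UNIV. (\<rho> / \<theta>) ^ (N $ s - j $ s)) *
            (\<bar>block_sum \<xi> (\<chi> s. q $ s * a ^ (j $ s)) (\<chi> s. a ^ (j $ s)) \<omega>\<bar> /
              (\<Prod>s\<in>UNIV. \<phi> s (real (a ^ (j $ s))))) \<le> \<delta>"
            by (simp add: W_def Y_def \<Psi>_def)
        qed (use a \<delta> in auto)
        also have "\<dots> < e" using \<open>0 < e\<close> K by (simp add: \<delta>_def)
        finally show "dist ((\<Sum>k\<in>{1..n}. \<xi> k \<omega>) / (\<Prod>s\<in>UNIV. \<phi> s (real (n $ s)))) 0 < e"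
          by simp
      qed
    qed
  qed
qed

end
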